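(* Let $n\ge 1$ and let $x=(x_{-n+1},\dots,x_{n-1})\in\mathbb{R}^{2n-1}$ be a vector such that $x_d\le 1$ for every $d\in\{-n+1,\dots,n-1\}$. Suppose that for every integer $k$ with $1\le k\le n-1$, $$\sum_{i=1}^{2k}(2k-i+1)\,x_{-n+i}\le k(k+1)\qquad\text{and}\qquad\sum_{i=1}^{2k}(2k-i+1)\,x_{n-i}\le k(k+1).$$ Then for every non-negative vector $w=(w_0,\dots,w_{n-1})\in\mathbb{R}^n$, $$\sum_{d=-n+1}^{n-1}v_d(w)\,x_d\le 2\sum_{i=0}^{n-1}w_i,$$ where $v_d(w)=\min\{\,w_i+w_j : 0\le i\le j\le n-1,\ i+j=d+(n-1)\,\}$ for each $d$.
   Context: Vectors in $\mathbb{R}^{2n-1}$ are indexed by $d=-n+1,\dots,n-1$, and vectors $w\in\mathbb{R}^n$ are indexed by $0,\dots,n-1$. "Non-negative" means all entries are $\ge 0$. *)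

theory Defs
  imports Complex_Main
begin

text \<open>\<open>min_pair_sum n w d\<close> is $v_d(w)$.  A vector with \<open>n\<close> entries is a function \<open>w\<close> on \<open>nat\<close> of
  which only the entries \<open>0, \<dots>, n - 1\<close> are used.  For \<open>d\<close> between \<open>- n + 1\<close> and \<open>n - 1\<close> the set
  below is finite and nonempty, so \<open>Min\<close> is its minimum.\<close>

definition min_pair_sum :: "nat \<Rightarrow> (nat \<Rightarrow> real) \<Rightarrow> int \<Rightarrow> real" where
  "min_pair_sum n w d =
     Min {w i + w j | i j. i \<le> j \<and> j < n \<and> int i + int j = d + (int n - 1)}"

end

theory Submission imports Defs begin

text \<open>Write \<open>N = n - 1\<close>, \<open>s = d + N\<close>, \<open>y\<^sub>s = x\<^sub>d\<close> and \<open>u\<^sub>s = v\<^sub>d(w)\<close>, so that \<open>s\<close> runs from \<open>0\<close> to \<open>2 N\<close>.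
  The argument is linear programming duality: \<open>u\<close> is split into a part that the two families of
  constraints control and a nonnegative remainder that is controlled by \<open>y\<^sub>s \<le> 1\<close>.

  The hypotheses say that \<open>y\<close> pairs with the hinge functions \<open>max 0 (2 k - s)\<close> and with their
  mirror images to at most \<open>k (k + 1)\<close>, which is the sum of the values of the hinge at the even
  points.  If \<open>N > 0\<close>, every nonnegative convex sequence with breakpoints at even points is a
  nonnegative combination of hinges; if \<open>N = 0\<close>, it is a constant and \<open>y\<^sub>0 \<le> 1\<close> takes their place.
  Hence for a nonnegative convex \<open>h\<close> on \<open>{0..N}\<close>, the sequence
  \<open>g\<^sub>2\<^sub>i = 2 h\<^sub>i\<close>, \<open>g\<^sub>2\<^sub>i\<^sub>+\<^sub>1 = h\<^sub>i + h\<^sub>i\<^sub>+\<^sub>1\<close> satisfies \<open>\<Sum> g\<^sub>s y\<^sub>s \<le> \<Sum> 2 h\<^sub>i\<close>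
  (\<open>central_pair_pairing_le\<close>).

  Take for \<open>h\<close> the largest convex minorant of \<open>w\<close>.  By convexity \<open>g \<le> u\<close>, so
  \<open>\<Sum> u\<^sub>s y\<^sub>s \<le> \<Sum> g\<^sub>s y\<^sub>s + \<Sum> (u\<^sub>s - g\<^sub>s)\<close>, and what remains to be shown is
  \<open>\<Sum> u\<^sub>s \<le> 2 \<Sum>\<^sub>i\<^sub>\<le>\<^sub>N w\<^sub>i + \<Sum>\<^sub>i\<^sub><\<^sub>N (h\<^sub>i + h\<^sub>i\<^sub>+\<^sub>1)\<close>.  Between consecutive contact points \<open>p < q\<close> of \<open>h\<close>
  and \<open>w\<close> the minorant is affine, so \<open>h\<^sub>i + h\<^sub>i\<^sub>+\<^sub>1\<close> sums to \<open>(q - p) (w\<^sub>p + w\<^sub>q)\<close>, and the bounds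
  \<open>u\<^sub>p\<^sub>+\<^sub>j \<le> w\<^sub>p + w\<^sub>j\<close> and \<open>u\<^sub>q\<^sub>+\<^sub>j \<le> w\<^sub>q + w\<^sub>j\<close> for \<open>p \<le> j < q\<close>, which cover every index from
  \<open>2 p\<close> to \<open>2 q - 1\<close> once, add up to exactly the required amount
  (\<open>sum_pair_bound_le\<close>).  The last index contributes \<open>u\<^sub>2\<^sub>N \<le> 2 w\<^sub>N\<close>.\<close>

section \<open>Convex sequences\<close>

definition convex_upto :: "nat \<Rightarrow> (nat \<Rightarrow> real) \<Rightarrow> bool" where
  "convex_upto N h \<longleftrightarrow> (\<forall>i. i + 2 \<le> N \<longrightarrow> 2 * h (i + 1) \<le> h i + h (i + 2))"

lemma convex_uptoD: "convex_upto N h \<Longrightarrow> i + 2 \<le> N \<Longrightarrow> 2 * h (i + 1) \<le> h i + h (i + 2)"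
  unfolding convex_upto_def by blast

lemma convex_upto_mono: "convex_upto N h \<Longrightarrow> M \<le> N \<Longrightarrow> convex_upto M h"
  unfolding convex_upto_def by auto

lemma convex_upto_rev:
  assumes "convex_upto N h"
  shows "convex_upto N (\<lambda>i. h (N - i))"
  unfolding convex_upto_def
proof (intro allI impI)
  fix i assume "i + 2 \<le> N"
  then obtain k where "N = k + i + 2" by (metis add.commute add.assoc le_Suc_ex)
  then show "2 * h (N - (i + 1)) \<le> h (N - i) + h (N - (i + 2))"
    using convex_uptoD[OF assms, of k] by (simp add: add.commute)
qed

lemma convex_upto_slope_mono:
  assumes "convex_upto N h" "i \<le> j" "j + 1 \<le> N"
  shows "h (i + 1) - h i \<le> h (j + 1) - h j"
  using assms(2,3)
proof (induction j rule: dec_induct)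
  case base
  show ?case by simp
next
  case (step j)
  then show ?case using convex_uptoD[OF assms(1), of j] by simp
qed

text \<open>The central pair has the smallest sum because moving two indices towards each other
  exchanges an outer slope for an inner one.\<close>

lemma convex_upto_central_pair_le:
  assumes "convex_upto N h" "i \<le> j" "j \<le> N"
  shows "h ((i + j) div 2) + h ((i + j + 1) div 2) \<le> h i + h j"
  using assms(2,3)
proof (induction "j - i" arbitrary: i j rule: less_induct)
  case less
  show ?case
  proof (cases "j \<le> i + 1")
    case True
    then have "j = i \<or> j = i + 1" using less.prems by linarith
    then show ?thesis
    proof
      assume "j = i"
      moreover have "(i + i) div 2 = i" "(i + i + 1) div 2 = i" by presburger+
      ultimately show ?thesis by simp
    next
      assume "j = i + 1"
      moreover have "(i + (i + 1)) div 2 = i" "(i + (i + 1) + 1) div 2 = i + 1" by presburger+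
      ultimately show ?thesis by simp
    qed
  next
    case False
    then obtain k where k: "j = k + 1" "i + 1 \<le> k"
      by (metis Suc_eq_plus1 Suc_leI add_leD2 le_add_diff_inverse2 not_le_imp_less not_less_eq_eq)
    have "h ((i + 1 + k) div 2) + h ((i + 1 + k + 1) div 2) \<le> h (i + 1) + h k"
      using k less.prems by (intro less.hyps) auto
    moreover have "h (i + 1) - h i \<le> h (k + 1) - h k"
      using k less.prems by (intro convex_upto_slope_mono[OF assms(1)]) auto
    ultimately show ?thesis using k(1) by (simp add: algebra_simps)
  qed
qed

section \<open>Pairing with nonnegative convex sequences\<close>

text \<open>This is summation by parts, done twice: \<open>\<Sum> z\<^sub>i (h\<^sub>i - h\<^sub>m\<^sub>+\<^sub>1)\<close> is the left-hand side plus the sum of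
  the second differences of \<open>h\<close> weighted by the hinge pairings of \<open>z\<close>.  The induction discards one
  nonnegative term of that sum in each step.\<close>

lemma left_pairing_lower_bound:
  fixes z h :: "nat \<Rightarrow> real"
  assumes "convex_upto (m + 1) h"
    and "\<And>k. 1 \<le> k \<Longrightarrow> k \<le> m \<Longrightarrow> 0 \<le> (\<Sum>i<k. (real k - real i) * z i)"
  shows "(\<Sum>i<m + 1. (real (m + 1) - real i) * z i) * (h m - h (m + 1))
           \<le> (\<Sum>i<m + 1. z i * (h i - h (m + 1)))"
  using assms
proof (induction m)
  case 0
  then show ?case by simp
next
  case (Suc m)
  let ?Z = "\<lambda>k. \<Sum>i<k. (real k - real i) * z i"
  let ?S = "\<Sum>i<m + 2. z i"
  have IH: "?Z (m + 1) * (h m - h (m + 1)) \<le> (\<Sum>i<m + 1. z i * (h i - h (m + 1)))"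
    using Suc.prems by (intro Suc.IH convex_upto_mono[OF Suc.prems(1)]) auto
  have "h (m + 1) - h (m + 2) \<le> h m - h (m + 1)"
    using convex_uptoD[OF Suc.prems(1), of m] by simp
  moreover have "0 \<le> ?Z (m + 1)" by (rule Suc.prems(2)) auto
  ultimately have "?Z (m + 1) * (h (m + 1) - h (m + 2)) \<le> ?Z (m + 1) * (h m - h (m + 1))"
    by (rule mult_left_mono)
  moreover have "?Z (m + 2) = ?Z (m + 1) + ?S"
    by (simp add: sum.distrib algebra_simps sum_subtractf sum_distrib_left)
  moreover have "(\<Sum>i<m + 2. z i * (h i - h (m + 2)))
      = (\<Sum>i<m + 1. z i * (h i - h (m + 1))) + ?S * (h (m + 1) - h (m + 2))"
    by (simp add: sum.distrib algebra_simps sum_subtractf sum_distrib_left sum_distrib_right)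
  ultimately have "?Z (m + 2) * (h (m + 1) - h (m + 2)) \<le> (\<Sum>i<m + 2. z i * (h i - h (m + 2)))"
    using IH by (simp add: distrib_right)
  then show ?case by simp
qed

lemma left_pairing_nonneg:
  fixes z h :: "nat \<Rightarrow> real"
  assumes "convex_upto m h" "\<And>i. i \<le> m \<Longrightarrow> h m \<le> h i"
    and "\<And>k. 1 \<le> k \<Longrightarrow> k \<le> m \<Longrightarrow> 0 \<le> (\<Sum>i<k. (real k - real i) * z i)"
  shows "0 \<le> (\<Sum>i<m. z i * (h i - h m))"
proof (cases m)
  case (Suc k)
  have "0 \<le> (\<Sum>i<k + 1. (real (k + 1) - real i) * z i) * (h k - h (k + 1))"
    using assms(2)[of k] assms(3)[of "k + 1"] Suc by (intro mult_nonneg_nonneg) auto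
  also have "\<dots> \<le> (\<Sum>i<k + 1. z i * (h i - h (k + 1)))"
    using assms Suc by (intro left_pairing_lower_bound) auto
  finally show ?thesis using Suc by simp
qed simp

text \<open>Splitting \<open>h\<close> at a minimum \<open>m\<close> gives the constant \<open>h m\<close>, a decreasing convex part that vanishes from \<open>m\<close>
  on and an increasing convex part that vanishes up to \<open>m\<close>.  The three parts pair nonnegatively with
  \<open>z\<close> by \<open>total\<close>, \<open>left\<close> and \<open>right\<close>, respectively.\<close>

lemma convex_pairing_nonneg:
  fixes z h :: "nat \<Rightarrow> real"
  assumes convex: "convex_upto N h" and nonneg: "\<And>i. i \<le> N \<Longrightarrow> 0 \<le> h i"
    and total: "0 \<le> (\<Sum>i\<le>N. z i)"
    and left: "\<And>k. 1 \<le> k \<Longrightarrow> k \<le> N \<Longrightarrow> 0 \<le> (\<Sum>i<k. (real k - real i) * z i)"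
    and right: "\<And>k. 1 \<le> k \<Longrightarrow> k \<le> N \<Longrightarrow> 0 \<le> (\<Sum>i<k. (real k - real i) * z (N - i))"
  shows "0 \<le> (\<Sum>i\<le>N. z i * h i)"
proof -
  obtain m where m: "m \<le> N" "\<And>i. i \<le> N \<Longrightarrow> h m \<le> h i"
    using ex_is_arg_min_if_finite[of "{..N}" h]
    unfolding is_arg_min_def by (auto simp: not_less)
  have "0 \<le> (\<Sum>i<m. z i * (h i - h m))"
    using m by (intro left_pairing_nonneg convex_upto_mono[OF convex] left) auto
  moreover have "0 \<le> (\<Sum>i<N - m. z (N - i) * (h (N - i) - h (N - (N - m))))"
    using m
    by (intro left_pairing_nonneg[where h = "\<lambda>i. h (N - i)" and z = "\<lambda>i. z (N - i)"]
          convex_upto_mono[OF convex_upto_rev[OF convex]] right) auto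
  moreover have "(\<Sum>i<N - m. z (N - i) * (h (N - i) - h (N - (N - m))))
      = (\<Sum>i\<in>{m<..N}. z i * (h i - h m))"
    using m(1)
    by (intro sum.reindex_bij_witness[of _ "\<lambda>i. N - i" "\<lambda>i. N - i"]) auto
  moreover have "(\<Sum>i\<le>N. z i * (h i - h m))
      = (\<Sum>i<m. z i * (h i - h m)) + (\<Sum>i\<in>{m<..N}. z i * (h i - h m))"
  proof -
    have "{..N} = insert m ({..<m} \<union> {m<..N})" using m(1) by auto
    moreover have "{..<m} \<inter> {m<..N} = {}" by auto
    ultimately show ?thesis by (simp add: sum.union_disjoint)
  qed
  moreover have "(\<Sum>i\<le>N. z i * (h i - h m)) = (\<Sum>i\<le>N. z i * h i) - (\<Sum>i\<le>N. z i) * h m"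
    by (simp add: algebra_simps sum_subtractf sum_distrib_left)
  moreover have "0 \<le> (\<Sum>i\<le>N. z i) * h m"
    using total nonneg m(1) by simp
  ultimately show ?thesis by linarith
qed

section \<open>The central pair sums of a convex sequence\<close>

definition central_pair_sum :: "(nat \<Rightarrow> real) \<Rightarrow> nat \<Rightarrow> real" where
  "central_pair_sum h s = h (s div 2) + h ((s + 1) div 2)"

lemma central_pair_sum_even [simp]: "central_pair_sum h (2 * i) = 2 * h i"
  by (simp add: central_pair_sum_def)

lemma central_pair_sum_odd [simp]: "central_pair_sum h (Suc (2 * i)) = h i + h (Suc i)"
  by (simp add: central_pair_sum_def)

lemma sum_central_pair_sum:
  "(\<Sum>s\<le>2 * M. central_pair_sum h s) = 2 * (\<Sum>i\<le>M. h i) + (\<Sum>i<M. h i + h (i + 1))"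
proof (induction M)
  case (Suc M)
  have "central_pair_sum h (Suc (Suc (2 * M))) = 2 * h (Suc M)"
    using central_pair_sum_even[of h "Suc M"] by simp
  with Suc show ?case by simp
qed (simp add: central_pair_sum_def)

text \<open>Collecting the coefficient of each \<open>h i\<close> turns a pairing of length \<open>2 M + 1\<close> into one of length
  \<open>M + 1\<close>.  Integer indices let the interior formula for the coefficients cover the two ends as well,
  at the cost of the two subtracted terms.\<close>

lemma sum_central_pair_sum_mult:
  fixes y :: "int \<Rightarrow> real"
  shows "(\<Sum>s\<le>2 * M. central_pair_sum h s * y (int s))
    = (\<Sum>i\<le>M. (y (2 * int i - 1) + 2 * y (2 * int i) + y (2 * int i + 1)) * h i)
        - y (- 1) * h 0 - y (2 * int M + 1) * h M"
proof (induction M)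
  case (Suc M)
  let ?c = "\<lambda>i. y (2 * int i - 1) + 2 * y (2 * int i) + y (2 * int i + 1)"
  have "central_pair_sum h (Suc (Suc (2 * M))) = 2 * h (Suc M)"
    using central_pair_sum_even[of h "Suc M"] by simp
  then have "(\<Sum>s\<le>2 * Suc M. central_pair_sum h s * y (int s))
      = (\<Sum>s\<le>2 * M. central_pair_sum h s * y (int s))
          + (h M + h (Suc M)) * y (2 * int M + 1) + 2 * h (Suc M) * y (2 * int (Suc M))"
    by (simp add: add.commute)
  also have "\<dots> = (\<Sum>i\<le>M. ?c i * h i) + ?c (Suc M) * h (Suc M)
      - y (- 1) * h 0 - y (2 * int (Suc M) + 1) * h (Suc M)"
    unfolding Suc.IH by (simp add: algebra_simps)
  finally show ?case by simp
qed (simp add: central_pair_sum_def algebra_simps)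

text \<open>The factor \<open>2 - \<dots>\<close> is the coefficient of \<open>h i\<close> in \<open>2 \<Sum> h\<^sub>i - \<Sum> g\<^sub>s y\<^sub>s\<close>.  Its pairing with the hinge
  at \<open>k\<close> is the slack of the \<open>k\<close>-th constraint on \<open>y\<close>.\<close>

lemma hinge_pairing_eq:
  fixes y :: "int \<Rightarrow> real"
  assumes "y (- 1) = 0"
  shows "(\<Sum>i<k. (real k - real i) * (2 - y (2 * int i - 1) - 2 * y (2 * int i) - y (2 * int i + 1)))
     = real k * (real k + 1) - (\<Sum>s<2 * k. (2 * real k - real s) * y (int s))"
proof (induction k)
  case (Suc k)
  let ?z = "\<lambda>i. 2 - y (2 * int i - 1) - 2 * y (2 * int i) - y (2 * int i + 1)"
  have tot: "(\<Sum>i<k. ?z i) = 2 * real k - 2 * (\<Sum>s<2 * k. y (int s)) + y (2 * int k - 1)" for k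
    using assms by (induction k) (auto simp: algebra_simps)
  have "(\<Sum>i<Suc k. (real (Suc k) - real i) * f i)
      = (\<Sum>i<k. (real k - real i) * f i) + (\<Sum>i<Suc k. f i)" for f :: "nat \<Rightarrow> real"
    by (simp add: sum.distrib sum_subtractf algebra_simps)
  note this[of ?z]
  moreover have "(\<Sum>s<2 * Suc k. (2 * real (Suc k) - real s) * y (int s))
      = (\<Sum>s<2 * k. (2 * real k - real s) * y (int s)) + 2 * (\<Sum>s<2 * k. y (int s))
          + 2 * y (2 * int k) + y (2 * int k + 1)"
    by (simp add: algebra_simps sum.distrib sum_distrib_left sum_subtractf)
  ultimately show ?case
    using Suc.IH tot[of "Suc k"] by (simp add: algebra_simps)
qed simp

text \<open>The slack \<open>2 \<Sum> h\<^sub>i - \<Sum> g\<^sub>s y\<^sub>s\<close> is the pairing of \<open>h\<close> with a coefficient sequence \<open>z\<close>, and the constraints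
  on \<open>y\<close> say that \<open>z\<close> pairs nonnegatively with hinges.\<close>

lemma central_pair_pairing_le:
  fixes y :: "int \<Rightarrow> real" and h :: "nat \<Rightarrow> real"
  assumes convex: "convex_upto N h" and nonneg: "\<And>i. i \<le> N \<Longrightarrow> 0 \<le> h i"
    and y0: "y 0 \<le> 1"
    and left: "\<And>k. 1 \<le> k \<Longrightarrow> k \<le> N \<Longrightarrow>
      (\<Sum>s<2 * k. (2 * real k - real s) * y (int s)) \<le> real k * (real k + 1)"
    and right: "\<And>k. 1 \<le> k \<Longrightarrow> k \<le> N \<Longrightarrow>
      (\<Sum>s<2 * k. (2 * real k - real s) * y (2 * int N - int s)) \<le> real k * (real k + 1)"
  shows "(\<Sum>s\<le>2 * N. central_pair_sum h s * y (int s)) \<le> 2 * (\<Sum>i\<le>N. h i)"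
proof -
  \<comment> \<open>Extending by zero makes the coefficients of \<open>h 0\<close> and \<open>h N\<close> instances of the interior formula.\<close>
  define t where "t s = (if 0 \<le> s \<and> s \<le> 2 * int N then y s else 0)" for s
  define z where "z i = 2 - t (2 * int i - 1) - 2 * t (2 * int i) - t (2 * int i + 1)" for i :: nat
  have t_neg: "t (- 1) = 0" and t_big: "t (2 * int N + 1) = 0" by (auto simp: t_def)
  have L: "0 \<le> (\<Sum>i<k. (real k - real i) * z i)" if "1 \<le> k" "k \<le> N" for k
  proof -
    have "(\<Sum>s<2 * k. (2 * real k - real s) * t (int s))
        = (\<Sum>s<2 * k. (2 * real k - real s) * y (int s))"
      using that by (intro sum.cong) (auto simp: t_def)
    then show ?thesis using left[OF that] hinge_pairing_eq[of t k, OF t_neg]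
      by (simp add: z_def)
  qed
  have R: "0 \<le> (\<Sum>i<k. (real k - real i) * z (N - i))" if "1 \<le> k" "k \<le> N" for k
  proof -
    let ?t = "\<lambda>s. t (2 * int N - s)"
    have "(\<Sum>i<k. (real k - real i) * z (N - i))
        = (\<Sum>i<k. (real k - real i) * (2 - ?t (2 * int i - 1) - 2 * ?t (2 * int i) - ?t (2 * int i + 1)))"
      using that
      by (intro sum.cong) (auto simp: z_def of_nat_diff algebra_simps)
    also have "\<dots> = real k * (real k + 1) - (\<Sum>s<2 * k. (2 * real k - real s) * ?t (int s))"
      by (rule hinge_pairing_eq) (simp add: t_big)
    also have "(\<Sum>s<2 * k. (2 * real k - real s) * ?t (int s))
        = (\<Sum>s<2 * k. (2 * real k - real s) * y (2 * int N - int s))"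
      using that by (intro sum.cong) (auto simp: t_def)
    finally show ?thesis using right[OF that] by simp
  qed
  have T: "0 \<le> (\<Sum>i\<le>N. z i)"
  proof (cases "N = 0")
    case True
    then show ?thesis using y0 by (simp add: z_def t_def)
  next
    case False
    \<comment> \<open>A constant is a multiple of the sum of the two full-length hinges \<open>N - i\<close> and \<open>i\<close>.\<close>
    have "(\<Sum>i<N. (real N - real i) * z (N - i)) = (\<Sum>i\<in>{0<..N}. real i * z i)"
      by (intro sum.reindex_bij_witness[of _ "\<lambda>i. N - i" "\<lambda>i. N - i"]) (auto simp: of_nat_diff)
    also have "\<dots> = (\<Sum>i\<le>N. real i * z i)"
      by (intro sum.mono_neutral_left) auto
    finally have *: "0 \<le> (\<Sum>i\<le>N. real i * z i)" using R[of N] False by simp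
    have "(\<Sum>i<N. (real N - real i) * z i) = (\<Sum>i\<le>N. (real N - real i) * z i)"
      by (intro sum.mono_neutral_left) auto
    then have "0 \<le> (\<Sum>i\<le>N. (real N - real i) * z i)" using L[of N] False by simp
    with * have "0 \<le> (\<Sum>i\<le>N. (real N - real i) * z i) + (\<Sum>i\<le>N. real i * z i)" by simp
    also have "\<dots> = real N * (\<Sum>i\<le>N. z i)"
      by (simp add: sum.distrib[symmetric] sum_distrib_left algebra_simps)
    finally show ?thesis using False by (simp add: zero_le_mult_iff)
  qed
  have "(\<Sum>s\<le>2 * N. central_pair_sum h s * y (int s)) = (\<Sum>s\<le>2 * N. central_pair_sum h s * t (int s))"
    by (intro sum.cong) (auto simp: t_def)
  also have "\<dots> = 2 * (\<Sum>i\<le>N. h i) - (\<Sum>i\<le>N. z i * h i)"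
    unfolding sum_central_pair_sum_mult t_neg t_big
    by (simp add: z_def sum_distrib_left sum_subtractf[symmetric] algebra_simps)
  also have "\<dots> \<le> 2 * (\<Sum>i\<le>N. h i)"
    using convex_pairing_nonneg[OF convex nonneg T L R] by simp
  finally show ?thesis .
qed

section \<open>The largest convex minorant\<close>

text \<open>The pointwise supremum of all convex minorants is convex.  It touches \<open>w\<close> at both ends and is affine
  around every index where it stays below \<open>w\<close>, since otherwise raising that single value would give
  a larger convex minorant: raising a value can only break convexity at its own index.\<close>

lemma convex_minorant_exists:
  fixes w :: "nat \<Rightarrow> real"
  assumes nonneg: "\<And>i. i \<le> N \<Longrightarrow> 0 \<le> w i"
  obtains h where "convex_upto N h" "\<And>i. i \<le> N \<Longrightarrow> 0 \<le> h i" "\<And>i. i \<le> N \<Longrightarrow> h i \<le> w i"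
    "h 0 = w 0" "h N = w N"
    "\<And>i. i + 2 \<le> N \<Longrightarrow> h (i + 1) < w (i + 1) \<Longrightarrow> h (i + 2) - h (i + 1) = h (i + 1) - h i"
proof -
  define C where "C = {c. convex_upto N c \<and> (\<forall>i\<le>N. c i \<le> w i)}"
  define h where "h i = (SUP c\<in>C. c i)" for i
  have zero: "(\<lambda>_. 0) \<in> C" using nonneg by (auto simp: C_def convex_upto_def)
  have upper: "c i \<le> h i" if "c \<in> C" "i \<le> N" for c i
    unfolding h_def using that
    by (intro cSUP_upper bdd_aboveI[of _ "w i"]) (auto simp: C_def)
  have least: "h i \<le> b" if "\<And>c. c \<in> C \<Longrightarrow> c i \<le> b" for i b
    unfolding h_def using zero that by (intro cSUP_least) auto
  have conv: "convex_upto N h"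
    unfolding convex_upto_def
  proof (intro allI impI)
    fix i assume i: "i + 2 \<le> N"
    have "h (i + 1) \<le> (h i + h (i + 2)) / 2"
    proof (rule least)
      fix c assume c: "c \<in> C"
      then have "2 * c (i + 1) \<le> c i + c (i + 2)"
        using i by (intro convex_uptoD[of N]) (auto simp: C_def)
      then show "c (i + 1) \<le> (h i + h (i + 2)) / 2"
        using upper[OF c, of i] upper[OF c, of "i + 2"] i by simp
    qed
    then show "2 * h (i + 1) \<le> h i + h (i + 2)" by simp
  qed
  have below: "h i \<le> w i" if "i \<le> N" for i
    using that by (intro least) (auto simp: C_def)
  \<comment> \<open>The bound on \<open>2 * v\<close> is convexity at \<open>i\<close>; it is demanded only for an interior index.\<close>
  have raise: "v \<le> h i" if i: "i \<le> N" and "v \<le> w i"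
    and v: "\<And>j. i = j + 1 \<Longrightarrow> i < N \<Longrightarrow> 2 * v \<le> h j + h (j + 2)" for i v
  proof (rule ccontr)
    assume less: "\<not> v \<le> h i"
    have "2 * (h(i := v)) (j + 1) \<le> (h(i := v)) j + (h(i := v)) (j + 2)" if "j + 2 \<le> N" for j
      using convex_uptoD[OF conv that] less v[of j] that by auto
    then have "h(i := v) \<in> C"
      using below \<open>v \<le> w i\<close> by (auto simp: C_def convex_upto_def)
    from upper[OF this i] less show False by simp
  qed
  show thesis
  proof (rule that[OF conv _ below])
    show "0 \<le> h i" if "i \<le> N" for i using upper[OF zero that] .
    show "h 0 = w 0" using below[of 0] raise[of 0 "w 0"] by auto
    show "h N = w N" using below[of N] raise[of N "w N"] by auto
    fix i assume i: "i + 2 \<le> N" and less: "h (i + 1) < w (i + 1)"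
    have "min (w (i + 1)) ((h i + h (i + 2)) / 2) \<le> h (i + 1)"
      using i by (intro raise) (auto simp: min_def)
    with less convex_uptoD[OF conv i]
    show "h (i + 2) - h (i + 1) = h (i + 1) - h i" by (auto simp: min_def split: if_splits)
  qed
qed

lemma trapezoid_sum:
  fixes h :: "nat \<Rightarrow> real"
  assumes "p \<le> q" and "\<And>i. p \<le> i \<Longrightarrow> i + 2 \<le> q \<Longrightarrow> h (i + 2) - h (i + 1) = h (i + 1) - h i"
  shows "(\<Sum>i=p..<q. h i + h (i + 1)) = (real q - real p) * (h p + h q)"
proof -
  define \<delta> where "\<delta> = h (p + 1) - h p"
  have slope: "h (i + 1) - h i = \<delta>" if "p \<le> i" "i + 1 \<le> q" for i
    using that
  proof (induction i rule: dec_induct)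
    case (step i)
    then show ?case using assms(2)[of i] by simp
  qed (simp add: \<delta>_def)
  have affine: "h i = h p + (real i - real p) * \<delta>" if "p \<le> i" "i \<le> q" for i
    using that
  proof (induction i rule: dec_induct)
    case (step i)
    then show ?case using slope[of i] by (simp add: algebra_simps)
  qed simp
  have "(\<Sum>i=p..<r. h i + h (i + 1)) = (real r - real p) * (h p + h r)" if "p \<le> r" "r \<le> q" for r
    using that
  proof (induction r rule: dec_induct)
    case (step r)
    have h: "h r = h p + (real r - real p) * \<delta>" "h (Suc r) = h p + (real (Suc r) - real p) * \<delta>"
      using step affine[of r] affine[of "Suc r"] by auto
    have "(\<Sum>i=p..<Suc r. h i + h (i + 1)) = (real r - real p) * (h p + h r) + (h r + h (Suc r))"
      using step by simp
    also have "\<dots> = (real (Suc r) - real p) * (h p + h (Suc r))"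
      unfolding h by (simp add: algebra_simps)
    finally show ?case .
  qed simp
  then show ?thesis using assms(1) by simp
qed

text \<open>Induction over the contact points of \<open>h\<close> and \<open>w\<close>: the step goes from the last contact point \<open>p\<close> before \<open>m\<close>
  to \<open>m\<close>, with the indices below \<open>p + m\<close> paired with \<open>p\<close> and the others with \<open>m\<close>.\<close>

lemma sum_pair_bound_le:
  fixes u w h :: "nat \<Rightarrow> real"
  assumes pair: "\<And>i j. i \<le> N \<Longrightarrow> j \<le> N \<Longrightarrow> u (i + j) \<le> w i + w j"
    and below: "\<And>i. i \<le> N \<Longrightarrow> h i \<le> w i"
    and "h 0 = w 0"
    and affine: "\<And>i. i + 2 \<le> N \<Longrightarrow> h (i + 1) < w (i + 1) \<Longrightarrow>
        h (i + 2) - h (i + 1) = h (i + 1) - h i"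
    and "m \<le> N" "h m = w m"
  shows "(\<Sum>s<2 * m. u s) \<le> 2 * (\<Sum>i<m. w i) + (\<Sum>i<m. h i + h (i + 1))"
  using assms(5,6)
proof (induction m rule: less_induct)
  case (less m)
  show ?case
  proof (cases "m = 0")
    case False
    define p where "p = Max {i. i < m \<and> h i = w i}"
    have "p \<in> {i. i < m \<and> h i = w i}"
      unfolding p_def using False \<open>h 0 = w 0\<close> by (intro Max_in) auto
    then have p: "p < m" "h p = w p" by auto
    have strict: "h i < w i" if "p < i" "i < m" for i
    proof -
      have "h i \<noteq> w i"
        using that Max_ge[of "{i. i < m \<and> h i = w i}" i] unfolding p_def by fastforce
      with below[of i] that less.prems show ?thesis by simp
    qed
    have split: "(\<Sum>i<b. f i) = (\<Sum>i<a. f i) + (\<Sum>i=a..<b. f i)" if "a \<le> b"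
      for f :: "nat \<Rightarrow> real" and a b :: nat
      using that sum.atLeastLessThan_concat[of 0 a b f] by (simp add: atLeast0LessThan)
    have "(\<Sum>i=p..<m. h i + h (i + 1)) = (real m - real p) * (h p + h m)"
      using p less.prems strict by (intro trapezoid_sum affine) auto
    also have "\<dots> = (\<Sum>j=p..<m. w p) + (\<Sum>j=p..<m. w m)"
      using p less.prems by (simp add: algebra_simps of_nat_diff)
    finally have trap: "(\<Sum>i=p..<m. h i + h (i + 1)) = \<dots>" .
    have "(\<Sum>s=2 * p..<2 * m. u s) = (\<Sum>s=p + p..<m + p. u s) + (\<Sum>s=p + m..<m + m. u s)"
      using p sum.atLeastLessThan_concat[of "2 * p" "m + p" "2 * m" u] by (simp add: mult_2 add.commute)
    also have "\<dots> = (\<Sum>j=p..<m. u (j + p)) + (\<Sum>j=p..<m. u (j + m))"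
      by (simp only: sum.shift_bounds_nat_ivl)
    also have "\<dots> \<le> (\<Sum>j=p..<m. w j + w p) + (\<Sum>j=p..<m. w j + w m)"
      using p less.prems by (intro add_mono sum_mono pair) auto
    also have "\<dots> = 2 * (\<Sum>j=p..<m. w j) + (\<Sum>i=p..<m. h i + h (i + 1))"
      unfolding trap by (simp only: sum.distrib)
    finally have step: "(\<Sum>s=2 * p..<2 * m. u s) \<le> \<dots>" .
    have IH: "(\<Sum>s<2 * p. u s) \<le> 2 * (\<Sum>i<p. w i) + (\<Sum>i<p. h i + h (i + 1))"
      using p less.prems by (intro less.IH) auto
    have "p \<le> m" "2 * p \<le> 2 * m" using p by auto
    then show ?thesis
      using IH step split[of p m w] split[of p m "\<lambda>i. h i + h (i + 1)"] split[of "2 * p" "2 * m" u]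
      by linarith
  qed simp
qed

section \<open>The inequality\<close>

lemma min_pair_sum_eq:
  "min_pair_sum (Suc N) w (int s - int N) = Min ((\<lambda>(i, j). w i + w j) ` {(i, j). i \<le> j \<and> j \<le> N \<and> i + j = s})"
proof -
  have "int i + int j = int s - int N + (int (Suc N) - 1) \<longleftrightarrow> i + j = s" for i j by linarith
  then show ?thesis
    unfolding min_pair_sum_def less_Suc_eq_le by (intro arg_cong[where f = Min]) (simp add: image_def, blast)
qed

lemma finite_index_pairs: "finite {(i, j). i \<le> j \<and> j \<le> N \<and> i + j = (s::nat)}"
  by (rule finite_subset[of _ "{..N} \<times> {..N}"]) auto

lemma min_pair_sum_le:
  assumes "i \<le> N" "j \<le> N"
  shows "min_pair_sum (Suc N) w (int (i + j) - int N) \<le> w i + w j"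
proof -
  have "min_pair_sum (Suc N) w (int (i + j) - int N) \<le> w (min i j) + w (max i j)"
    unfolding min_pair_sum_eq using finite_index_pairs assms
    by (intro Min_le finite_imageI) (auto intro!: image_eqI[of _ _ "(min i j, max i j)"])
  then show ?thesis by (auto simp: min_def max_def split: if_splits)
qed

lemma min_pair_sum_attained:
  assumes "s \<le> 2 * N"
  obtains i j where "i \<le> j" "j \<le> N" "i + j = s"
    "min_pair_sum (Suc N) w (int s - int N) = w i + w j"
proof -
  have "(s div 2, s - s div 2) \<in> {(i, j). i \<le> j \<and> j \<le> N \<and> i + j = s}"
    using assms by auto
  then have "min_pair_sum (Suc N) w (int s - int N)
      \<in> (\<lambda>(i, j). w i + w j) ` {(i, j). i \<le> j \<and> j \<le> N \<and> i + j = s}"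
    unfolding min_pair_sum_eq using finite_index_pairs by (intro Min_in finite_imageI) blast+
  then show thesis using that by auto
qed

theorem proposition4p2:
  fixes n :: nat and x :: "int \<Rightarrow> real" and w :: "nat \<Rightarrow> real"
  assumes "n \<ge> 1"
    and "\<And>d. d \<in> {- int n + 1..int n - 1} \<Longrightarrow> x d \<le> 1"
    and "\<And>k::nat. 1 \<le> k \<Longrightarrow> k \<le> n - 1 \<Longrightarrow>
           (\<Sum>i=1..2*k. (2 * real k - real i + 1) * x (- int n + int i)) \<le> real k * (real k + 1)"
    and "\<And>k::nat. 1 \<le> k \<Longrightarrow> k \<le> n - 1 \<Longrightarrow>
           (\<Sum>i=1..2*k. (2 * real k - real i + 1) * x (int n - int i)) \<le> real k * (real k + 1)"
    and "\<And>i. i < n \<Longrightarrow> w i \<ge> 0"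
  shows "(\<Sum>d = - int n + 1..int n - 1. min_pair_sum n w d * x d) \<le> 2 * (\<Sum>i<n. w i)"
proof -
  obtain N where N: "n = Suc N" using assms(1) by (cases n) auto
  define y where "y s = x (s - int N)" for s
  define u where "u s = min_pair_sum n w (int s - int N)" for s
  have y_le: "y (int s) \<le> 1" if "s \<le> 2 * N" for s
    using that by (auto simp: y_def N intro!: assms(2))
  obtain h where convex: "convex_upto N h" and nonneg: "\<And>i. i \<le> N \<Longrightarrow> 0 \<le> h i"
    and below: "\<And>i. i \<le> N \<Longrightarrow> h i \<le> w i" and ends: "h 0 = w 0" "h N = w N"
    and affine: "\<And>i. i + 2 \<le> N \<Longrightarrow> h (i + 1) < w (i + 1) \<Longrightarrow>
        h (i + 2) - h (i + 1) = h (i + 1) - h i"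
    using convex_minorant_exists[of N w] assms(5) N by (metis less_Suc_eq_le)
  let ?g = "central_pair_sum h"
  have pair: "u (i + j) \<le> w i + w j" if "i \<le> N" "j \<le> N" for i j
    unfolding u_def N using that by (rule min_pair_sum_le)
  have g_le: "?g s \<le> u s" if "s \<le> 2 * N" for s
  proof -
    obtain i j where ij: "i \<le> j" "j \<le> N" "i + j = s" "u s = w i + w j"
      using min_pair_sum_attained[OF \<open>s \<le> 2 * N\<close>, of w] unfolding u_def N by blast
    have "?g s \<le> h i + h j"
      using convex_upto_central_pair_le[OF convex ij(1,2)] ij(3) by (simp add: central_pair_sum_def)
    also have "\<dots> \<le> u s" using ij below[of i] below[of j] by simp
    finally show ?thesis .
  qed
  have shift: "(\<Sum>s<2 * k. f s) = (\<Sum>i=1..2 * k. f (i - 1))" for f :: "nat \<Rightarrow> real" and k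
    by (intro sum.reindex_bij_witness[of _ "\<lambda>i. i - 1" "\<lambda>i. i + 1"]) auto
  have left: "(\<Sum>s<2 * k. (2 * real k - real s) * y (int s)) \<le> real k * (real k + 1)"
    if "1 \<le> k" "k \<le> N" for k
  proof -
    have "(\<Sum>s<2 * k. (2 * real k - real s) * y (int s))
        = (\<Sum>i=1..2*k. (2 * real k - real i + 1) * x (- int n + int i))"
      unfolding shift y_def N by (intro sum.cong) (auto simp: of_nat_diff algebra_simps)
    with assms(3)[of k] that N show ?thesis by simp
  qed
  have right: "(\<Sum>s<2 * k. (2 * real k - real s) * y (2 * int N - int s)) \<le> real k * (real k + 1)"
    if "1 \<le> k" "k \<le> N" for k
  proof -
    have "(\<Sum>s<2 * k. (2 * real k - real s) * y (2 * int N - int s))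
        = (\<Sum>i=1..2*k. (2 * real k - real i + 1) * x (int n - int i))"
      unfolding shift y_def N by (intro sum.cong) (auto simp: of_nat_diff algebra_simps)
    with assms(4)[of k] that N show ?thesis by simp
  qed
  have "(\<Sum>d = - int n + 1..int n - 1. min_pair_sum n w d * x d) = (\<Sum>s\<le>2 * N. u s * y (int s))"
    unfolding u_def y_def
    by (intro sum.reindex_bij_witness[of _ "\<lambda>s. int s - int N" "\<lambda>d. nat (d + int N)"])
      (auto simp: N)
  also have "\<dots> = (\<Sum>s\<le>2 * N. ?g s * y (int s)) + (\<Sum>s\<le>2 * N. (u s - ?g s) * y (int s))"
    by (simp add: sum.distrib[symmetric] algebra_simps)
  also have "\<dots> \<le> 2 * (\<Sum>i\<le>N. h i) + (\<Sum>s\<le>2 * N. (u s - ?g s) * 1)"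
    using y_le[of 0] g_le y_le
    by (intro add_mono central_pair_pairing_le[OF convex nonneg _ left right] sum_mono mult_left_mono) auto
  also have "\<dots> = (\<Sum>s\<le>2 * N. u s) - (\<Sum>i<N. h i + h (i + 1))"
    using sum_central_pair_sum[of h N] by (simp add: sum_subtractf)
  also have "(\<Sum>s\<le>2 * N. u s) = (\<Sum>s<2 * N. u s) + u (N + N)"
    by (simp add: lessThan_Suc_atMost[symmetric] mult_2)
  also have "\<dots> \<le> (2 * (\<Sum>i<N. w i) + (\<Sum>i<N. h i + h (i + 1))) + (w N + w N)"
    using sum_pair_bound_le[of N u w h N, OF pair below ends(1) affine] ends(2) pair[of N N]
    by (intro add_mono) auto
  finally show ?thesis by (simp add: N)
qed

end
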